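(* Let $p$ be an odd prime, $q\in\mathbb{C}_p$ with $|q-1|_p<1$, $\chi$ a Dirichlet character of odd conductor $d$ with $(d,p)=1$, $\zeta\in\mathcal{T}_p$, and $n\in\mathbb{N}\cup\{0\}$. Then $$I_{-q^{-1}}\left(\zeta^{x}\chi(x)x^{n}\right)=\int_{X}\zeta^{x}\chi(x)x^{n}\,d\mu_{-q^{-1}}(x)=\frac{(-1)^{n}}{(1+q)^{n}}\mathcal{A}_{n,\chi,\zeta}(-q).$$
   Context: $\mathbb{C}_p$ is the completion of an algebraic closure of $\mathbb{Q}_p$, $|p|_p=1/p$. $\mathcal{T}_p=\bigcup_{n\ge0}\{\zeta:\zeta^{p^n}=1\}$ is the set of all $p$-power roots of unity. $X=\varprojlim_N \mathbb{Z}/dp^N\mathbb{Z}$ (functions on $\mathbb{Z}_p$ are viewed as functions on $X$ via the natural projection). For $x$ an integer put $[x]_{-q}=\frac{1-(-q)^x}{1+q}$. The $p$-adic fermionic $q$-integral with parameter $q^{-1}$ is $$I_{-q^{-1}}(f)=\int_X f(x)\,d\mu_{-q^{-1}}(x)=\lim_{N\to\infty}\frac{1}{[dp^N]_{-q^{-1}}}\sum_{x=0}^{dp^N-1}(-1)^x q^{-x}f(x),$$ where $[m]_{-q^{-1}}=\frac{1-(-q^{-1})^m}{1+q^{-1}}$. With $[2]_q=1+q$, the Dirichlet-type twisted Eulerian polynomials $\mathcal{A}_{n,\chi,\zeta}(-q)$ are defined by the generating function $$\sum_{n=0}^{\infty}\mathcal{A}_{n,\chi,\zeta}(-q)\frac{t^n}{n!}=[2]_q\sum_{l=0}^{d-1}(-1)^l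 q^{d-l+1}\zeta^l\chi(l)\frac{e^{-l(1+q)t}}{\zeta^d e^{-d(1+q)t}+q^d}.$$
   Formalization: The exponent of q in the generating function of the twisted Eulerian polynomials is corrected from d-l+1 to d-l-1; as printed the formula is off by a factor q^2 (for d=1, trivial χ, ζ=1, n=0 it would say 1=q^2). *)

theory Defs
  imports Complex_Main
    "HOL-Computational_Algebra.Polynomial"
    "HOL-Computational_Algebra.Formal_Power_Series"
    "HOL-Number_Theory.Cong"
begin

definition vtendsto :: "('a::field \<Rightarrow> real) \<Rightarrow> (nat \<Rightarrow> 'a) \<Rightarrow> 'a \<Rightarrow> bool" where
  "vtendsto v s L \<longleftrightarrow> (\<lambda>N. v (s N - L)) \<longlonglongrightarrow> 0"

definition vCauchy :: "('a::field \<Rightarrow> real) \<Rightarrow> (nat \<Rightarrow> 'a) \<Rightarrow> bool" where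
  "vCauchy v s \<longleftrightarrow> (\<forall>e>0. \<exists>M. \<forall>m\<ge>M. \<forall>n\<ge>M. v (s m - s n) < e)"

text \<open>
  Inside a complete field with absolute value \<open>v\<close>, the closure of the rationals is their
  completion; for \<open>v\<close> normalised by \<open>v p = 1 / p\<close> this is \<open>\<rat>\<^sub>p\<close>.
\<close>

definition padic_rationals :: "('a::field_char_0 \<Rightarrow> real) \<Rightarrow> 'a set" where
  "padic_rationals v = {x. \<exists>s :: nat \<Rightarrow> rat. vtendsto v (\<lambda>n. of_rat (s n)) x}"

definition padic_algebraics :: "('a::field_char_0 \<Rightarrow> real) \<Rightarrow> 'a set" where
  "padic_algebraics v =
     {x. \<exists>P. P \<noteq> 0 \<and> (\<forall>i. coeff P i \<in> padic_rationals v) \<and> poly P x = 0}"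

text \<open>
  \<open>padic_complex p v\<close>: the type \<open>'a\<close> with absolute value \<open>v\<close> is a completion of an algebraic
  closure of \<open>\<rat>\<^sub>p\<close>, i.e. it is complete and has a dense subfield that is algebraic over \<open>\<rat>\<^sub>p\<close> and
  algebraically closed. This determines the field and \<open>v\<close> up to isometric isomorphism.
\<close>

locale padic_complex =
  fixes p :: nat and v :: "'a::field_char_0 \<Rightarrow> real"
  assumes prime_p: "prime p"
    and v_nonneg: "v x \<ge> 0"
    and v_eq_0_iff: "v x = 0 \<longleftrightarrow> x = 0"
    and v_mult: "v (x * y) = v x * v y"
    and v_ultrametric: "v (x + y) \<le> max (v x) (v y)"
    and v_p: "v (of_nat p) = 1 / real p"
    and complete: "vCauchy v s \<Longrightarrow> \<exists>L. vtendsto v s L"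
    and alg_closed: "degree P > 0 \<Longrightarrow> (\<And>i. coeff P i \<in> padic_algebraics v) \<Longrightarrow>
                       \<exists>z \<in> padic_algebraics v. poly P z = 0"
    and dense: "e > 0 \<Longrightarrow> \<exists>y \<in> padic_algebraics v. v (x - y) < e"

definition p_power_roots_of_unity :: "nat \<Rightarrow> 'a::field set" where
  "p_power_roots_of_unity p = (\<Union>n. {\<zeta>. \<zeta> ^ (p ^ n) = 1})"

definition dirichlet_char :: "nat \<Rightarrow> (int \<Rightarrow> 'a::field) \<Rightarrow> bool" where
  "dirichlet_char m \<chi> \<longleftrightarrow>
     m > 0 \<and> \<chi> 1 = 1 \<and> (\<forall>a b. \<chi> (a * b) = \<chi> a * \<chi> b) \<and>
     (\<forall>a. \<chi> (a + int m) = \<chi> a) \<and> (\<forall>a. \<chi> a = 0 \<longleftrightarrow> \<not> coprime a (int m))"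

definition induced_modulus :: "nat \<Rightarrow> (int \<Rightarrow> 'a::field) \<Rightarrow> nat \<Rightarrow> bool" where
  "induced_modulus m \<chi> k \<longleftrightarrow>
     k > 0 \<and> k dvd m \<and> (\<forall>a. coprime a (int m) \<and> [a = 1] (mod int k) \<longrightarrow> \<chi> a = 1)"

definition dirichlet_conductor :: "nat \<Rightarrow> (int \<Rightarrow> 'a::field) \<Rightarrow> nat" where
  "dirichlet_conductor m \<chi> = (LEAST k. induced_modulus m \<chi> k)"

text \<open>\<open>qbracket_neg q x\<close> is \<open>[x]\<close> with subscript \<open>-q\<close>.\<close>

definition qbracket_neg :: "'a::field \<Rightarrow> int \<Rightarrow> 'a" where
  "qbracket_neg q x = (1 - (-q) powi x) / (1 + q)"

text \<open>
  The Riemann sums of the fermionic integral over \<open>X\<close> with parameter \<open>1/q\<close>. They only involve the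
  values of the integrand at the non-negative integers, which are dense in \<open>X\<close>.
\<close>

definition fermionic_sum :: "nat \<Rightarrow> nat \<Rightarrow> 'a::field \<Rightarrow> (nat \<Rightarrow> 'a) \<Rightarrow> nat \<Rightarrow> 'a" where
  "fermionic_sum p d q f N =
     1 / qbracket_neg (inverse q) (int (d * p ^ N)) *
       (\<Sum>x<d * p ^ N. (-1) ^ x * q powi (- int x) * f x)"

definition fermionic_integrable ::
    "('a::field \<Rightarrow> real) \<Rightarrow> nat \<Rightarrow> nat \<Rightarrow> 'a \<Rightarrow> (nat \<Rightarrow> 'a) \<Rightarrow> bool" where
  "fermionic_integrable v p d q f \<longleftrightarrow> (\<exists>L. vtendsto v (fermionic_sum p d q f) L)"

definition fermionic_integral ::
    "('a::field \<Rightarrow> real) \<Rightarrow> nat \<Rightarrow> nat \<Rightarrow> 'a \<Rightarrow> (nat \<Rightarrow> 'a) \<Rightarrow> 'a" where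
  "fermionic_integral v p d q f = (THE L. vtendsto v (fermionic_sum p d q f) L)"

text \<open>
  The exponent of \<open>q\<close> is \<open>d - l - 1\<close>. The source prints \<open>d - l + 1\<close>, which is a misprint: for
  \<open>d = 1\<close>, \<open>\<zeta> = 1\<close> and trivial \<open>\<chi>\<close> only \<open>d - l - 1\<close> gives the Eulerian generating function
  \<open>(1 + q) / (exp (-(1 + q) t) + q)\<close>, and with \<open>d - l + 1\<close> the right-hand side of the integral
  formula would be off by the factor \<open>q\<^sup>2\<close> (already \<open>1 = q\<^sup>2\<close> for \<open>n = 0\<close>).
\<close>

definition twisted_eulerian_gf :: "nat \<Rightarrow> (int \<Rightarrow> 'a::field_char_0) \<Rightarrow> 'a \<Rightarrow> 'a \<Rightarrow> 'a fps" where
  "twisted_eulerian_gf d \<chi> \<zeta> q =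
     fps_const (1 + q) *
       (\<Sum>l<d. fps_const ((-1) ^ l * q ^ (d - l - 1) * \<zeta> ^ l * \<chi> (int l)) *
          (fps_exp (- of_nat l * (1 + q)) /
            (fps_const (\<zeta> ^ d) * fps_exp (- of_nat d * (1 + q)) + fps_const (q ^ d))))"

definition twisted_eulerian :: "nat \<Rightarrow> nat \<Rightarrow> (int \<Rightarrow> 'a::field_char_0) \<Rightarrow> 'a \<Rightarrow> 'a \<Rightarrow> 'a" where
  "twisted_eulerian n d \<chi> \<zeta> q = fact n * fps_nth (twisted_eulerian_gf d \<chi> \<zeta> q) n"

end

theory Submission imports Defs begin

text \<open>
  Put \<open>M = d p\<^sup>N\<close>, \<open>a = -(1 + q)\<close> and let \<open>G\<close> be the generating function of the twisted Eulerian
  polynomials. Splitting \<open>x < M\<close> into residue classes modulo \<open>d\<close> and summing a geometric series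
  shows that, as soon as \<open>\<zeta>\<^sup>M = 1\<close>, the \<open>N\<close>-th Riemann sums of \<open>\<zeta>\<^sup>x \<chi>(x) e\<^bsup>axt\<^esup>\<close> are
  \<open>G(t) (q\<^sup>M + e\<^bsup>aMt\<^esup>) / (q\<^sup>M + 1) = G(t) + G(t) (e\<^bsup>aMt\<^esup> - 1) / (q\<^sup>M + 1)\<close>.
  As \<open>p\<close> is odd and \<open>q\<close> is a one-unit, \<open>q\<^sup>M + 1\<close> has absolute value \<open>1\<close>, while the coefficient
  of \<open>t\<^sup>k\<close> in \<open>e\<^bsup>aMt\<^esup> - 1\<close> is \<open>M\<^sup>k\<close> times a constant for \<open>k \<ge> 1\<close>, hence tends to \<open>0\<close>.
\<close>

section \<open>Generating functions of the Riemann sums\<close>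

text \<open>Writing \<open>x = l + d * j\<close> separates the variables. The induction peels off
  the last block of \<open>d\<close> terms, where periodicity leaves the extra factor
  \<open>(U ^ d) ^ m\<close>. A general semiring is allowed because \<open>U\<close> will be a power
  series.\<close>

lemma sum_periodic_times_power:
  fixes U :: "'b::comm_semiring_1"
  assumes "\<And>x. c (x + d) = c x"
  shows "(\<Sum>x<d * m. c x * U ^ x) = (\<Sum>l<d. c l * U ^ l) * (\<Sum>j<m. (U ^ d) ^ j)"
proof (induction m)
  case (Suc m)
  have period: "c (x + d * j) = c x" for x j
  proof (induction j)
    case (Suc j)
    show ?case using assms[of "x + d * j"] Suc by (simp add: algebra_simps)
  qed simp
  have "(\<Sum>x<d * Suc m. c x * U ^ x)
      = (\<Sum>x<d * m. c x * U ^ x) + (\<Sum>x = d * m..<d * m + d. c x * U ^ x)"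
    by (simp add: lessThan_atLeast0 sum.atLeastLessThan_concat add.commute)
  also have "(\<Sum>x = d * m..<d * m + d. c x * U ^ x) = (\<Sum>l<d. c (l + d * m) * U ^ (l + d * m))"
    using sum.shift_bounds_nat_ivl[of "\<lambda>x. c x * U ^ x" 0 "d * m" d]
    by (simp add: lessThan_atLeast0 add.commute)
  also have "\<dots> = (\<Sum>l<d. c l * U ^ l) * (U ^ d) ^ m"
    by (simp add: period power_add power_mult sum_distrib_right mult.assoc)
  finally show ?case using Suc by (simp add: algebra_simps)
qed simp

text \<open>The common denominator has constant term \<open>\<zeta> ^ d + q ^ d\<close>; since this
  is nonzero, the denominator is a unit and can be cleared. All exponentials become powers of a
  single series, ready for a geometric sum.\<close>

lemma twisted_eulerian_gf_eq:
  fixes q \<zeta> :: "'a::field_char_0"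
  assumes "q ^ d + \<zeta> ^ d \<noteq> 0"
  shows "twisted_eulerian_gf d \<chi> \<zeta> q *
           (fps_const (\<zeta> ^ d) * fps_exp (- (1 + q)) ^ d + fps_const (q ^ d)) =
         fps_const (1 + q) *
           (\<Sum>l<d. fps_const ((-1) ^ l * q ^ (d - l - 1) * \<zeta> ^ l * \<chi> (int l)) *
              fps_exp (- (1 + q)) ^ l)"
proof -
  define D where "D = fps_const (\<zeta> ^ d) * fps_exp (- (1 + q)) ^ d + fps_const (q ^ d)"
  have expo: "fps_exp (- of_nat l * (1 + q)) = fps_exp (- (1 + q)) ^ l" for l
    by (simp add: fps_exp_power_mult algebra_simps)
  have D0: "fps_nth D 0 \<noteq> 0"
    using assms by (simp add: D_def fps_exp_power_mult add.commute)
  have "f / D * D = f" for f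
    using D0 by (simp add: fps_divide_unit mult.assoc inverse_mult_eq_1)
  then show ?thesis
    unfolding twisted_eulerian_gf_def expo D_def[symmetric]
    by (simp add: sum_distrib_right mult.assoc)
qed

text \<open>With ratio \<open>U = - (\<zeta> / q) * E\<close> the sum equals
  \<open>B * (1 - U ^ M) / (1 - U ^ d)\<close>. The factor \<open>(1 + q) * q ^ (M - 1)\<close> is
  the numerator of the normalisation \<open>1 / [M]\<close>, whose denominator is
  \<open>q ^ M + 1\<close>.\<close>

lemma riemann_sum_gf_eq:
  fixes q \<zeta> :: "'a::field_char_0"
  assumes "q \<noteq> 0" "q ^ d + \<zeta> ^ d \<noteq> 0" "odd d" "odd m" "\<zeta> ^ (d * m) = 1"
    and period: "\<And>x. \<chi> (x + int d) = \<chi> x"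
  shows "fps_const ((1 + q) * q ^ (d * m - 1)) *
           (\<Sum>x<d * m. fps_const (\<chi> (int x)) * (fps_const (- \<zeta> / q) * fps_exp (- (1 + q))) ^ x) =
         twisted_eulerian_gf d \<chi> \<zeta> q * (fps_const (q ^ (d * m)) + fps_exp (- (1 + q)) ^ (d * m))"
proof -
  define M where "M = d * m"
  define E where "E = fps_exp (- (1 + q))"
  define U where "U = fps_const (- \<zeta> / q) * E"
  define D where "D = fps_const (\<zeta> ^ d) * E ^ d + fps_const (q ^ d)"
  define B where "B = (\<Sum>l<d. fps_const (\<chi> (int l)) * U ^ l)"
  have "odd M" using assms by (simp add: M_def)
  then have "M > 0" by (auto intro: Nat.gr0I)
  have "d > 0" using \<open>odd d\<close> by (auto intro: Nat.gr0I)
  have D0: "D \<noteq> 0"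
  proof
    assume "D = 0"
    then have "fps_nth D 0 = 0" by simp
    then show False using assms(2) by (simp add: D_def E_def fps_exp_power_mult add.commute)
  qed
  \<comment> \<open>Odd \<open>k\<close> turns the sign of \<open>(- \<zeta>) ^ k\<close> into a
    plus. The case \<open>k = d\<close> yields the denominator \<open>D\<close>, and
    \<open>k = M\<close> the factor \<open>q ^ M + E ^ M\<close>, as
    \<open>\<zeta> ^ M = 1\<close>.\<close>
  have UM: "fps_const (q ^ k) * (1 - U ^ k) = fps_const (q ^ k) + fps_const (\<zeta> ^ k) * E ^ k"
    if "odd k" for k
  proof -
    have "q ^ k * (- \<zeta> / q) ^ k = - (\<zeta> ^ k)"
      using that \<open>q \<noteq> 0\<close> by (simp add: power_divide)
    then have "fps_const (q ^ k) * U ^ k = - (fps_const (\<zeta> ^ k) * E ^ k)"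
      by (simp only: U_def power_mult_distrib fps_const_power fps_const_mult
            mult.assoc[symmetric]) (simp flip: fps_const_neg)
    then show ?thesis by (simp add: right_diff_distrib)
  qed
  have G: "twisted_eulerian_gf d \<chi> \<zeta> q * D = fps_const ((1 + q) * q ^ (d - 1)) * B"
  proof -
    have "fps_const ((-1) ^ l * q ^ (d - l - 1) * \<zeta> ^ l * \<chi> (int l)) * E ^ l =
          fps_const (q ^ (d - 1)) * (fps_const (\<chi> (int l)) * U ^ l)" if "l < d" for l
    proof -
      \<comment> \<open>Splitting off \<open>q ^ (d - 1)\<close> leaves \<open>q\<close> to the
        power \<open>-l\<close>, exactly what \<open>U ^ l\<close> contains.\<close>
      have "q ^ (d - 1) = q ^ (d - l - 1) * q ^ l"
        using that by (simp add: power_add[symmetric])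
      then have "(-1) ^ l * q ^ (d - l - 1) * \<zeta> ^ l * \<chi> (int l) =
          q ^ (d - 1) * (\<chi> (int l) * (- \<zeta> / q) ^ l)"
        using \<open>q \<noteq> 0\<close> power_minus[of "\<zeta> / q" l] by (simp add: power_divide)
      then show ?thesis
        by (simp only: U_def power_mult_distrib fps_const_power fps_const_mult mult.assoc[symmetric])
    qed
    then have "(\<Sum>l<d. fps_const ((-1) ^ l * q ^ (d - l - 1) * \<zeta> ^ l * \<chi> (int l)) * E ^ l) =
        fps_const (q ^ (d - 1)) * B"
      unfolding B_def sum_distrib_left by (intro sum.cong) auto
    moreover note twisted_eulerian_gf_eq[OF assms(2), of \<chi>, folded E_def, folded D_def]
    ultimately show ?thesis
      by (simp only: fps_const_mult mult.assoc[symmetric])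
  qed
  have "(\<Sum>x<M. fps_const (\<chi> (int x)) * U ^ x) = B * (\<Sum>j<m. (U ^ d) ^ j)"
    unfolding M_def B_def
    by (rule sum_periodic_times_power) (simp add: period)
  then have P: "(\<Sum>x<M. fps_const (\<chi> (int x)) * U ^ x) * (1 - U ^ d) = B * (1 - U ^ M)"
    using one_diff_power_eq[of "U ^ d" m] by (simp add: M_def power_mult mult_ac)
  have D: "D = fps_const (q ^ d) * (1 - U ^ d)"
    using UM[OF \<open>odd d\<close>] by (simp add: D_def)
  have qM: "fps_const (q ^ M) + E ^ M = fps_const (q ^ M) * (1 - U ^ M)"
    using UM[OF \<open>odd M\<close>] assms(5) by (simp add: M_def)
  \<comment> \<open>Both sides have total exponent \<open>M + d - 1\<close>; the natural-number
    subtractions are exact since \<open>M\<close> and \<open>d\<close> are positive.\<close>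
  have qs: "(1 + q) * q ^ (M - 1) * q ^ d = (1 + q) * q ^ (d - 1) * q ^ M"
    using \<open>M > 0\<close> \<open>d > 0\<close> by (simp add: power_add[symmetric] mult.assoc add.commute)
  have "fps_const ((1 + q) * q ^ (M - 1)) * (\<Sum>x<M. fps_const (\<chi> (int x)) * U ^ x) * D
      = fps_const ((1 + q) * q ^ (M - 1) * q ^ d) *
          ((\<Sum>x<M. fps_const (\<chi> (int x)) * U ^ x) * (1 - U ^ d))"
    unfolding D fps_const_mult[symmetric] by (simp only: mult_ac)
  also have "\<dots> = fps_const ((1 + q) * q ^ (d - 1)) * B * (fps_const (q ^ M) * (1 - U ^ M))"
    unfolding P qs unfolding fps_const_mult[symmetric] by (simp only: mult_ac)
  also have "\<dots> = twisted_eulerian_gf d \<chi> \<zeta> q * (fps_const (q ^ M) + E ^ M) * D"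
    unfolding qM G[symmetric] by (simp only: mult_ac)
  \<comment> \<open>Power series over a field form an integral domain, so the nonzero factor
    \<open>D\<close> cancels.\<close>
  finally show ?thesis using D0 by (simp add: M_def U_def E_def)
qed

text \<open>Coefficients of \<open>t ^ n\<close> are compared in \<open>riemann_sum_gf_eq\<close>.
  On the left, \<open>fps_exp a ^ x\<close> contributes \<open>a ^ n * x ^ n / n!\<close>, so
  division by \<open>a ^ n\<close> produces the sign and the power of \<open>1 + q\<close>. The
  second summand is the error term that has to vanish in the limit.\<close>

lemma fermionic_sum_eq:
  fixes q \<zeta> :: "'a::field_char_0"
  defines "a \<equiv> - (1 + q)"
  assumes "q \<noteq> 0" "1 + q \<noteq> 0" "q ^ d + \<zeta> ^ d \<noteq> 0" "odd d" "odd p"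
    and M: "M = d * p ^ N" and "\<zeta> ^ M = 1" and qM: "q ^ M + 1 \<noteq> 0"
    and period: "\<And>x. \<chi> (x + int d) = \<chi> x"
  shows "fermionic_sum p d q (\<lambda>x. \<zeta> ^ x * \<chi> (int x) * of_nat x ^ n) N =
         (-1) ^ n / (1 + q) ^ n *
           (twisted_eulerian n d \<chi> \<zeta> q +
            fact n / (q ^ M + 1) *
              fps_nth ((fps_exp (of_nat M * a) - 1) * twisted_eulerian_gf d \<chi> \<zeta> q) n)"
proof -
  define G where "G = twisted_eulerian_gf d \<chi> \<zeta> q"
  define S where "S = (\<Sum>x<M. (- \<zeta> / q) ^ x * \<chi> (int x) * of_nat x ^ n)"
  define R where "R = fps_nth ((fps_exp (of_nat M * a) - 1) * G) n"
  have "odd M" using assms by simp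
  then have "M > 0" by (auto intro: Nat.gr0I)
  have "a \<noteq> 0" using assms by (simp add: a_def add_eq_0_iff)
  have gf: "fps_const ((1 + q) * q ^ (M - 1)) *
           (\<Sum>x<M. fps_const (\<chi> (int x)) * (fps_const (- \<zeta> / q) * fps_exp a) ^ x) =
         G * (fps_const (q ^ M) + fps_exp a ^ M)"
    unfolding a_def G_def M using assms by (intro riemann_sum_gf_eq) auto
  have "fps_nth (fps_const (\<chi> (int x)) * (fps_const (- \<zeta> / q) * fps_exp a) ^ x) n =
      a ^ n / fact n * ((- \<zeta> / q) ^ x * \<chi> (int x) * of_nat x ^ n)" for x
    by (simp add: power_mult_distrib fps_const_power fps_exp_power_mult)
  then have L: "fps_nth (fps_const ((1 + q) * q ^ (M - 1)) *
           (\<Sum>x<M. fps_const (\<chi> (int x)) * (fps_const (- \<zeta> / q) * fps_exp a) ^ x)) n =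
      (1 + q) * q ^ (M - 1) * (a ^ n / fact n * S)"
    by (simp only: fps_mult_left_const_nth fps_sum_nth S_def sum_distrib_left)
  have "G * (fps_const (q ^ M) + fps_exp a ^ M) =
      fps_const (q ^ M + 1) * G + (fps_exp (of_nat M * a) - 1) * G"
    by (simp add: fps_exp_power_mult algebra_simps flip: fps_const_add)
  then have "fps_nth (G * (fps_const (q ^ M) + fps_exp a ^ M)) n = (q ^ M + 1) * fps_nth G n + R"
    by (simp add: R_def)
  with gf L have main: "(1 + q) * q ^ (M - 1) * (a ^ n / fact n * S) = (q ^ M + 1) * fps_nth G n + R"
    by simp
  have "(-1) ^ x * q powi (- int x) * (\<zeta> ^ x * \<chi> (int x) * of_nat x ^ n) =
      (- \<zeta> / q) ^ x * \<chi> (int x) * of_nat x ^ n" for x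
    using power_minus[of "\<zeta> / q" x]
    by (simp add: power_int_minus power_divide divide_inverse power_mult_distrib power_inverse mult_ac)
  moreover have "1 / qbracket_neg (inverse q) (int M) = (1 + q) * q ^ (M - 1) / (q ^ M + 1)"
  proof -
    have "(1 - (- inverse q) powi (int M)) = (q ^ M + 1) / q ^ M"
      using \<open>odd M\<close> \<open>q \<noteq> 0\<close> by (simp add: field_simps)
    moreover have "1 + inverse q = (1 + q) / q"
      using \<open>q \<noteq> 0\<close> by (simp add: field_simps)
    moreover have "q ^ M = q * q ^ (M - 1)" using \<open>M > 0\<close> by (simp add: power_eq_if)
    ultimately show ?thesis using \<open>q \<noteq> 0\<close> by (simp add: qbracket_neg_def)
  qed
  ultimately have "fermionic_sum p d q (\<lambda>x. \<zeta> ^ x * \<chi> (int x) * of_nat x ^ n) N =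
      (1 + q) * q ^ (M - 1) / (q ^ M + 1) * S"
    by (simp only: fermionic_sum_def S_def M)
  \<comment> \<open>Compensating factors are inserted so that the left-hand side of
    \<open>main\<close> appears literally.\<close>
  also have "\<dots> = fact n / a ^ n / (q ^ M + 1) * ((1 + q) * q ^ (M - 1) * (a ^ n / fact n * S))"
    using \<open>a \<noteq> 0\<close> by simp
  also have "\<dots> = 1 / a ^ n * (fact n * fps_nth G n + fact n / (q ^ M + 1) * R)"
    unfolding main using qM \<open>a \<noteq> 0\<close> by (simp add: field_simps)
  also have "1 / a ^ n = (-1) ^ n / (1 + q) ^ n"
    using power_minus[of "1 + q" n] by (cases "even n") (simp_all add: a_def)
  finally show ?thesis by (simp add: twisted_eulerian_def G_def R_def)
qed

section \<open>Absolute values of one-units\<close>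

context padic_complex
begin

lemma v_0 [simp]: "v 0 = 0"
  by (simp add: v_eq_0_iff)

lemma v_1 [simp]: "v 1 = 1"
  using v_mult[of 1 1] v_eq_0_iff[of 1] by simp

lemma v_minus [simp]: "v (- x) = v x"
proof -
  have "v (-1) * v (-1) = 1" using v_mult[of "-1" "-1"] by simp
  then have "v (-1) = 1"
    using v_nonneg[of "-1"] by (simp add: square_eq_1_iff)
  then show ?thesis using v_mult[of "-1" x] by simp
qed

lemma v_minus_commute: "v (x - y) = v (y - x)"
  using v_minus[of "x - y"] by simp

lemma v_power: "v (x ^ n) = v x ^ n"
  by (induction n) (simp_all add: v_mult)

lemma v_triangle: "v (x + y) \<le> v x + v y"
  using v_ultrametric[of x y] v_nonneg[of x] v_nonneg[of y] by linarith

lemma v_sum_le: "v (sum f A) \<le> (\<Sum>x\<in>A. v (f x))"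
proof (induction A rule: infinite_finite_induct)
  case (insert x A)
  then show ?case using v_triangle[of "f x" "sum f A"] by simp
qed simp_all

lemma v_of_nat_le_1: "v (of_nat n) \<le> 1"
proof (induction n)
  case (Suc n)
  then show ?case using v_ultrametric[of 1 "of_nat n"] by simp
qed simp

text \<open>Writing \<open>p = 2 * m + 1\<close> gives \<open>1 = p - 2 * m\<close>. Since
  \<open>p\<close> has absolute value below \<open>1\<close>, the term \<open>2 * m\<close> must
  have absolute value at least \<open>1\<close>, and \<open>m\<close> contributes at most
  \<open>1\<close>.\<close>

lemma v_2:
  assumes "odd p"
  shows "v 2 = 1"
proof (rule antisym)
  show "v 2 \<le> 1" using v_of_nat_le_1[of 2] by simp
  obtain m where m: "p = 2 * m + 1" using assms by (auto elim: oddE)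
  have "1 = of_nat p + - (2 * of_nat m :: 'a)" by (simp add: m)
  then have "1 \<le> max (v (of_nat p)) (v (2 * of_nat m))"
    by (metis v_1 v_minus v_ultrametric)
  moreover have "v (of_nat p) < 1"
    using prime_gt_1_nat[OF prime_p] by (simp add: v_p)
  moreover have "v (2 * of_nat m) \<le> v 2"
    using v_of_nat_le_1[of m] v_nonneg[of 2] by (simp add: v_mult mult_left_le)
  ultimately show "1 \<le> v 2" by linarith
qed

lemma v_one_unit:
  assumes "v (q - 1) < 1"
  shows "v q = 1"
proof (rule antisym)
  show "v q \<le> 1" using v_ultrametric[of "q - 1" 1] assms by simp
  show "1 \<le> v q" using v_ultrametric[of "1 - q" q] assms v_minus_commute[of q 1] by simp
qed

lemma v_one_unit_power:
  assumes "v (q - 1) < 1"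
  shows "v (q ^ m - 1) < 1"
proof (induction m)
  case (Suc m)
  have "q ^ Suc m - 1 = q * (q ^ m - 1) + (q - 1)" by (simp add: algebra_simps)
  then have "v (q ^ Suc m - 1) \<le> max (v q * v (q ^ m - 1)) (v (q - 1))"
    by (metis v_mult v_ultrametric)
  then show ?case using Suc assms v_one_unit[OF assms] by simp
qed simp

text \<open>In \<open>2 = (x + 1) + (1 - x)\<close> the left side has absolute value
  \<open>1\<close> and \<open>1 - x\<close> a smaller one, so \<open>x + 1\<close> must attain the
  maximum.\<close>

lemma v_one_unit_plus_1:
  assumes "odd p" "v (x - 1) < 1"
  shows "v (x + 1) = 1"
proof (rule antisym)
  show "v (x + 1) \<le> 1" using v_ultrametric[of x 1] v_one_unit[OF assms(2)] by simp
  show "1 \<le> v (x + 1)"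
    using v_ultrametric[of "x + 1" "1 - x"] v_2[OF assms(1)] assms(2) v_minus_commute[of x 1]
    by simp
qed

section \<open>Limits and convergence of the Riemann sums\<close>

text \<open>This makes the definite description in \<open>fermionic_integral\<close> denote the
  limit once convergence is known.\<close>

lemma vtendsto_unique:
  assumes "vtendsto v s L" "vtendsto v s L'"
  shows "L = L'"
proof -
  have "(\<lambda>N. v (s N - L) + v (s N - L')) \<longlonglongrightarrow> 0 + 0"
    using assms unfolding vtendsto_def by (intro tendsto_add)
  moreover have "v (L' - L) \<le> v (s N - L) + v (s N - L')" for N
    using v_triangle[of "s N - L" "L' - s N"] v_minus_commute[of "s N" L'] by simp
  ultimately have "v (L' - L) \<le> 0"
    by (intro tendsto_lowerbound[of _ 0 sequentially]) auto
  then show ?thesis using v_nonneg[of "L' - L"] v_eq_0_iff[of "L' - L"] by simp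
qed

lemma tendsto_v_of_nat_level: "(\<lambda>N. v (of_nat (d * p ^ N))) \<longlonglongrightarrow> 0"
proof -
  have "(\<lambda>N. v (of_nat d) * (1 / real p) ^ N) \<longlonglongrightarrow> v (of_nat d) * 0"
    using prime_gt_1_nat[OF prime_p] by (intro tendsto_intros LIMSEQ_realpow_zero) auto
  then show ?thesis by (simp add: v_mult v_power v_p)
qed

text \<open>For fixed \<open>n\<close> the coefficient is a convolution of \<open>n + 1\<close>
  terms, so the triangle inequality allows a termwise limit. The constants
  \<open>a ^ k / fact k\<close> and the coefficients of \<open>G\<close> are independent of
  \<open>N\<close>, so their size is harmless.\<close>

lemma tendsto_v_coeff_exp_minus_1_mult:
  assumes "(\<lambda>N. v (of_nat (M N))) \<longlonglongrightarrow> 0"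
  shows "(\<lambda>N. v (fps_nth ((fps_exp (of_nat (M N) * a) - 1) * G) n)) \<longlonglongrightarrow> 0"
proof (rule tendsto_0_le[where K = 1])
  define h where "h N k = v (fps_nth (fps_exp (of_nat (M N) * a) - 1) k)" for N k
  show "\<forall>\<^sub>F N in sequentially. norm (v (fps_nth ((fps_exp (of_nat (M N) * a) - 1) * G) n))
      \<le> norm (\<Sum>k=0..n. h N k * v (fps_nth G (n - k))) * 1"
  proof (intro always_eventually allI)
    fix N
    show "norm (v (fps_nth ((fps_exp (of_nat (M N) * a) - 1) * G) n))
      \<le> norm (\<Sum>k=0..n. h N k * v (fps_nth G (n - k))) * 1"
      unfolding fps_mult_nth h_def v_mult[symmetric] using v_nonneg v_sum_le
      by (simp add: sum_nonneg)
  qed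
  have "(\<lambda>N. h N k) \<longlonglongrightarrow> 0" for k
  \<comment> \<open>The constant term vanishes because \<open>1\<close> was subtracted; for positive
    \<open>k\<close> the factor \<open>M N ^ k\<close> tends to \<open>0\<close>.\<close>
  proof (cases "k = 0")
    case False
    have "(\<lambda>N. v (of_nat (M N)) ^ k * v (a ^ k / fact k)) \<longlonglongrightarrow> 0 ^ k * v (a ^ k / fact k)"
      by (intro tendsto_intros assms)
    then show ?thesis using False
      by (simp add: h_def power_0_left power_mult_distrib v_mult[symmetric] v_power[symmetric])
  qed (simp add: h_def)
  then have "(\<lambda>N. \<Sum>k=0..n. h N k * v (fps_nth G (n - k))) \<longlonglongrightarrow>
      (\<Sum>k=0..n. 0 * v (fps_nth G (n - k)))"
    by (intro tendsto_intros)
  then show "(\<lambda>N. \<Sum>k=0..n. h N k * v (fps_nth G (n - k))) \<longlonglongrightarrow> 0" by simp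
qed

lemma vtendsto_fermionic_sum:
  assumes "odd p" "v (q - 1) < 1" "odd d" "\<zeta> \<in> p_power_roots_of_unity p"
    and period: "\<And>x. \<chi> (x + int d) = \<chi> x"
  shows "vtendsto v (fermionic_sum p d q (\<lambda>x. \<zeta> ^ x * \<chi> (int x) * of_nat x ^ n))
           ((-1) ^ n / (1 + q) ^ n * twisted_eulerian n d \<chi> \<zeta> q)"
proof -
  obtain k where k: "\<zeta> ^ (p ^ k) = 1"
    using assms(4) by (auto simp: p_power_roots_of_unity_def)
  have vq: "v (q ^ m + 1) = 1" for m
    using assms by (intro v_one_unit_plus_1 v_one_unit_power)
  then have nz: "q ^ m + 1 \<noteq> 0" for m
    by (metis v_0 zero_neq_one)
  have "q \<noteq> 0" using v_one_unit[OF assms(2)] by auto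
  have "1 + q \<noteq> 0" using nz[of 1] by (simp add: add.commute)
  \<comment> \<open>Raising \<open>\<zeta> ^ d = - (q ^ d)\<close> to the odd power
    \<open>p ^ k\<close> would give \<open>1 = - (q ^ (d * p ^ k))\<close>, against
    \<open>nz\<close>.\<close>
  have "q ^ d + \<zeta> ^ d \<noteq> 0"
  proof
    assume "q ^ d + \<zeta> ^ d = 0"
    then have "\<zeta> ^ d = - (q ^ d)" by (simp add: add_eq_0_iff)
    then have "(\<zeta> ^ d) ^ (p ^ k) = - (q ^ (d * p ^ k))"
      using assms(1) by (simp add: power_mult)
    moreover have "(\<zeta> ^ d) ^ (p ^ k) = 1"
      using k by (metis power_mult mult.commute power_one)
    ultimately show False using nz[of "d * p ^ k"] by (simp add: add_eq_0_iff)
  qed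
  define C where "C = (-1) ^ n / (1 + q) ^ n"
  define R where "R N = fps_nth ((fps_exp (of_nat (d * p ^ N) * - (1 + q)) - 1) *
      twisted_eulerian_gf d \<chi> \<zeta> q) n" for N
  have diff: "fermionic_sum p d q (\<lambda>x. \<zeta> ^ x * \<chi> (int x) * of_nat x ^ n) N
      - C * twisted_eulerian n d \<chi> \<zeta> q = C * fact n * R N / (q ^ (d * p ^ N) + 1)"
    if "N \<ge> k" for N
  proof -
    \<comment> \<open>From level \<open>k\<close> on, \<open>p ^ k\<close> divides
      \<open>d * p ^ N\<close>, which gives the required \<open>\<zeta> ^ M = 1\<close>; the
      finitely many earlier levels do not affect the limit.\<close>
    have "d * p ^ N = p ^ k * (d * p ^ (N - k))"
      using that by (simp add: power_add[symmetric])
    then have "\<zeta> ^ (d * p ^ N) = 1" using k by (simp only: power_mult power_one)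
    from fermionic_sum_eq[OF \<open>q \<noteq> 0\<close> \<open>1 + q \<noteq> 0\<close> \<open>q ^ d + \<zeta> ^ d \<noteq> 0\<close> assms(3,1) refl this
        nz[of "d * p ^ N"], of \<chi> n, OF period]
    show ?thesis by (simp add: C_def R_def distrib_left mult.assoc)
  qed
  have "\<forall>\<^sub>F N in sequentially.
      v (C * fact n) * v (R N) =
      v (fermionic_sum p d q (\<lambda>x. \<zeta> ^ x * \<chi> (int x) * of_nat x ^ n) N
         - C * twisted_eulerian n d \<chi> \<zeta> q)"
    using eventually_ge_at_top[of k]
  proof eventually_elim
    case (elim N)
    \<comment> \<open>The factor \<open>v (q ^ (d * p ^ N) + 1)\<close> equals \<open>1\<close>;
      inserting it cancels the denominator of the error term.\<close>
    have "v (C * fact n) * v (R N) = v (C * fact n * R N / (q ^ (d * p ^ N) + 1)) * v (q ^ (d * p ^ N) + 1)"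
      unfolding v_mult[symmetric] using nz[of "d * p ^ N"] by simp
    then show ?case using diff[OF elim] vq by simp
  qed
  moreover have "(\<lambda>N. v (C * fact n) * v (R N)) \<longlonglongrightarrow> v (C * fact n) * 0"
    unfolding R_def
    by (intro tendsto_intros tendsto_v_coeff_exp_minus_1_mult tendsto_v_of_nat_level)
  ultimately show ?thesis
    unfolding vtendsto_def C_def[symmetric] by (simp add: Lim_transform_eventually)
qed

end

theorem theorem1:
  fixes p d n :: nat
    and v :: "'a::field_char_0 \<Rightarrow> real"
    and q \<zeta> :: 'a
    and \<chi> :: "int \<Rightarrow> 'a"
  assumes "prime p" and "odd p"
    and "padic_complex p v"
    and "v (q - 1) < 1"
    and "dirichlet_char d \<chi>" and "dirichlet_conductor d \<chi> = d"
    and "odd d" and "coprime d p"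
    and "\<zeta> \<in> p_power_roots_of_unity p"
  shows "fermionic_integrable v p d q (\<lambda>x. \<zeta> ^ x * \<chi> (int x) * of_nat x ^ n) \<and>
         fermionic_integral v p d q (\<lambda>x. \<zeta> ^ x * \<chi> (int x) * of_nat x ^ n) =
           (-1) ^ n / (1 + q) ^ n * twisted_eulerian n d \<chi> \<zeta> q"
proof -
  interpret padic_complex p v by fact
  have "vtendsto v (fermionic_sum p d q (\<lambda>x. \<zeta> ^ x * \<chi> (int x) * of_nat x ^ n))
           ((-1) ^ n / (1 + q) ^ n * twisted_eulerian n d \<chi> \<zeta> q)"
    using assms by (intro vtendsto_fermionic_sum) (auto simp: dirichlet_char_def)
  then show ?thesis
    unfolding fermionic_integrable_def fermionic_integral_def
    by (blast intro: the_equality vtendsto_unique)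
qed

end
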